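(* The products of the elements $\xi_\Gamma$ ($\Gamma\in M(n,d)$) and $\zeta_\Gamma$ ($\Gamma\in N(n,d)$) satisfy the following. (a) For $\Gamma_1\in M(n,d)$ and $\Gamma_2\in N(n,d)$, $\xi_{\Gamma_1}\zeta_{\Gamma_2}=\sum_{\Gamma\in N(n,d)}c^{\Gamma}_{\Gamma_1\Gamma_2}\zeta_\Gamma$, where $c^{\Gamma}_{\Gamma_1\Gamma_2}=\sum_{l_1,l_2}\epsilon(\Gamma_2,l_2)$, the sum running over all labellings $l_1$ of $\Gamma_1$ and $l_2$ of $\Gamma_2$ such that $(l_1,l_2)$ is compatible with the standard labelling $l$ of $\Gamma$. (b) For $\Gamma_1\in N(n,d)$ and $\Gamma_2\in M(n,d)$, $\zeta_{\Gamma_1}\xi_{\Gamma_2}=\sum_{\Gamma\in N(n,d)}c^{\Gamma}_{\Gamma_1\Gamma_2}\zeta_\Gamma$, where $c^{\Gamma}_{\Gamma_1\Gamma_2}=\sum_{l_1,l_2}\epsilon(\Gamma_1,l_1)$, the sum running over all labellings $l_1$ of $\Gamma_1$ and $l_2$ of $\Gamma_2$ such that $(l_1,l_2)$ is compatible with the standard labelling $l$ of $\Gamma$. (c) For $\Gamma_1,\Gamma_2\in N(n,d)$, $\zeta_{\Gamma_1}\zeta_{\Gamma_2}=\sum_{\Gamma\in M(n,d)}c^{\Gamma}_{\Gamma_1\Gamma_2}\xi_\Gamma$, where $c^{\Gamma}_{\Gamma_1\Gamma_2}=\sum_{l_1,l_2}\epsilon(\Gamma_1,l_1)\epsilon(\Gamma_2,l_2)$,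 the sum running over all labellings $l_1$ of $\Gamma_1$ and $l_2$ of $\Gamma_2$ such that $(l_1,l_2)$ is compatible with a fixed (arbitrary) labelling $l$ of $\Gamma$.
   Context: Let $F$ be a field of characteristic different from $2$, and $n,d$ positive integers; $[n]=\{1,\dots,n\}$, $[n']=\{1',\dots,n'\}$. $B(n,d)$ is the set of $n$-tuples $S=(S_1,\dots,S_n)$ of pairwise disjoint (possibly empty) sets with union $[d]$; the symmetric group $\mathbf{S}_d$ acts on the right by $S\cdot w=(w^{-1}(S_1),\dots,w^{-1}(S_n))$. $F[B(n,d)]$ is the space of functions $B(n,d)\to F$ with action $(\rho(w)f)(S)=f(S\cdot w)$; it is isomorphic to $(F^n)^{\otimes d}$ with $\mathbf{S}_d$ permuting tensor factors. $\mathrm{S}_F(n,d)=\mathrm{End}_{\mathbf{S}_d}(F[B(n,d)])$, and $\mathrm{S}^-_F(n,d)=\mathrm{Hom}_{\mathbf{S}_d}(F[B(n,d)],F[B(n,d)]\otimes\mathrm{sgn})$ is viewed as the space of linear endomorphisms $A$ of $F[B(n,d)]$ with $A\rho(w)=\mathrm{sgn}(w)\rho(w)A$ for all $w$. All products are compositions of endomorphisms of $F[B(n,d)]$ (i.e. taken in $\mathrm{AS}_F(n,d)=\mathrm{End}_{\mathbf{A}_d}((F^n)^{\otimes d})$, $\mathbf{A}_d$ the alternating group). $M(n,d)$ is the set of bipartite multigraphs with vertex set $[n']\coprod[n]$ and $d$ edges (each edge joins a vertex of $[n']$ to a vertex of $[n]$), and $N(n,d)\subset M(n,d)$ is the subset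 of simple graphs. A labelling of $\Gamma\in M(n,d)$ is a function $l:[d]\to[n']\times[n]$ such that $|l^{-1}(i',j)|$ is the number of edges joining $i'$ and $j$. For $S,T\in B(n,d)$, $\Gamma_{S,T}\in M(n,d)$ has $|S_j\cap T_i|$ edges between $i'$ and $j$; $l_{S,T}$ is its labelling with $l_{S,T}(s)=(i',j)$ when $s\in S_j\cap T_i$. The standard labelling $l_0$ of $\Gamma\in N(n,d)$ labels the edges $1,\dots,d$ in increasing lexicographic order, where $(i',j)<(r',s)$ if $i<r$, or $i=r$ and $j<s$. The sign $\epsilon(\Gamma,l)$ of a labelling $l$ of $\Gamma\in N(n,d)$ is the sign of the permutation of $[d]$ sending the $l_0$-label of each edge to its $l$-label. Put $\epsilon(\gamma_{S,T})=\epsilon(\Gamma_{S,T},l_{S,T})$ when $\Gamma_{S,T}\in N(n,d)$. For $\Gamma\in M(n,d)$: $\xi_\Gamma f(S)=\sum_{\{T\mid\Gamma_{S,T}=\Gamma\}}f(T)$; these form a basis of $\mathrm{S}_F(n,d)$. For $\Gamma\in N(n,d)$: $\zeta_\Gamma f(S)=\sum_{\{T\mid\Gamma_{S,T}=\Gamma\}}\epsilon(\gamma_{S,T})f(T)$; these form a basis of $\mathrm{S}^-_F(n,d)$. Compatibility: for labellings $l,l_1,l_2$ of $\Gamma,\Gamma_1,\Gamma_2$, the pair $(l_1,l_2)$ is compatible with $l$ if for every $s\in[d]$, writing $l_1(s)=(i_1',j_1)$ and $l_2(s)=(i_2',j_2)$, one has $i_1=j_2$ and $l(s)=(i_2',j_1)$.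 *)

theory Defs
  imports
    Complex_Main
    "HOL-Library.FuncSet"
    "HOL-Library.Multiset"
    "HOL-Library.Disjoint_Sets"
    "HOL-Library.Product_Lexorder"
    "HOL-Combinatorics.Permutations"
begin

text \<open>
  \<open>B(n,d)\<close>: tuples indexed by \<open>{1..n}\<close> of pairwise disjoint, possibly empty, sets with
  union \<open>{1..d}\<close>. They are extensional functions, so that equality of tuples is equality in HOL
  and the set is finite.
\<close>

definition tuples :: "nat \<Rightarrow> nat \<Rightarrow> (nat \<Rightarrow> nat set) set" where
  "tuples n d = {S \<in> extensional {1..n}.
     disjoint_family_on S {1..n} \<and> (\<Union>i\<in>{1..n}. S i) = {1..d}}"

text \<open>
  \<open>F[B(n,d)]\<close>, where \<open>F\<close> is the type \<^typ>\<open>'a\<close>. Its endomorphisms are extensional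
  functions on this space, and their product is \<^const>\<open>compose\<close>.
\<close>

definition fun_space :: "nat \<Rightarrow> nat \<Rightarrow> ((nat \<Rightarrow> nat set) \<Rightarrow> 'a) set" where
  "fun_space n d = tuples n d \<rightarrow>\<^sub>E UNIV"

type_synonym 'a operator = "((nat \<Rightarrow> nat set) \<Rightarrow> 'a) \<Rightarrow> ((nat \<Rightarrow> nat set) \<Rightarrow> 'a)"

definition lin_comb ::
    "nat \<Rightarrow> nat \<Rightarrow> 'i set \<Rightarrow> ('i \<Rightarrow> 'a) \<Rightarrow> ('i \<Rightarrow> 'a operator) \<Rightarrow> 'a::field operator" where
  "lin_comb n d I c A = (\<lambda>f\<in>fun_space n d. \<lambda>S\<in>tuples n d. \<Sum>i\<in>I. c i * A i f S)"

text \<open>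
  A bipartite multigraph on the vertex set \<open>[n'] \<Coprod> [n]\<close> is the multiset of its edges; the pair
  \<open>(i, j)\<close> stands for an edge joining \<open>i'\<close> to \<open>j\<close>, so the primed vertex is always the first
  component.
\<close>

type_synonym edge = "nat \<times> nat"

definition multigraphs :: "nat \<Rightarrow> nat \<Rightarrow> edge multiset set" where
  "multigraphs n d = {\<Gamma>. set_mset \<Gamma> \<subseteq> {1..n} \<times> {1..n} \<and> size \<Gamma> = d}"

definition simple_graphs :: "nat \<Rightarrow> nat \<Rightarrow> edge multiset set" where
  "simple_graphs n d = {\<Gamma> \<in> multigraphs n d. \<forall>e. count \<Gamma> e \<le> 1}"

definition labellings :: "nat \<Rightarrow> nat \<Rightarrow> edge multiset \<Rightarrow> (nat \<Rightarrow> edge) set" where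
  "labellings n d \<Gamma> = {l \<in> {1..d} \<rightarrow>\<^sub>E {1..n} \<times> {1..n}.
     \<forall>e \<in> {1..n} \<times> {1..n}. card {s \<in> {1..d}. l s = e} = count \<Gamma> e}"

definition graph_of :: "nat \<Rightarrow> (nat \<Rightarrow> nat set) \<Rightarrow> (nat \<Rightarrow> nat set) \<Rightarrow> edge multiset" where
  "graph_of n S T = (\<Sum>(i, j) \<in> {1..n} \<times> {1..n}. replicate_mset (card (S j \<inter> T i)) (i, j))"

definition labelling_of ::
    "nat \<Rightarrow> nat \<Rightarrow> (nat \<Rightarrow> nat set) \<Rightarrow> (nat \<Rightarrow> nat set) \<Rightarrow> nat \<Rightarrow> edge" where
  "labelling_of n d S T =
     (\<lambda>s\<in>{1..d}. (THE i. i \<in> {1..n} \<and> s \<in> T i, THE j. j \<in> {1..n} \<and> s \<in> S j))"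

text \<open>
  The order on pairs is the lexicographic one of \<^theory>\<open>HOL-Library.Product_Lexorder\<close>, and
  list positions start at 0 while labels start at 1.
\<close>

definition std_labelling :: "nat \<Rightarrow> edge multiset \<Rightarrow> nat \<Rightarrow> edge" where
  "std_labelling d \<Gamma> = (\<lambda>s\<in>{1..d}. sorted_list_of_multiset \<Gamma> ! (s - 1))"

text \<open>
  A labelling \<open>l\<close> of a simple graph is injective on \<open>{1..d}\<close>, and the label of an edge is its
  preimage under \<open>l\<close>. The permutation below therefore sends the standard label \<open>s\<close> of an edge
  to its \<open>l\<close>-label. The value is meaningful only for simple graphs.
\<close>

definition eps :: "nat \<Rightarrow> edge multiset \<Rightarrow> (nat \<Rightarrow> edge) \<Rightarrow> int" where
  "eps d \<Gamma> l = sign_on {1..d} (\<lambda>s. the_inv_into {1..d} l (std_labelling d \<Gamma> s))"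

definition xi :: "nat \<Rightarrow> nat \<Rightarrow> edge multiset \<Rightarrow> 'a::field operator" where
  "xi n d \<Gamma> = (\<lambda>f\<in>fun_space n d. \<lambda>S\<in>tuples n d.
     \<Sum>T\<in>{T \<in> tuples n d. graph_of n S T = \<Gamma>}. f T)"

definition zeta :: "nat \<Rightarrow> nat \<Rightarrow> edge multiset \<Rightarrow> 'a::field operator" where
  "zeta n d \<Gamma> = (\<lambda>f\<in>fun_space n d. \<lambda>S\<in>tuples n d.
     \<Sum>T\<in>{T \<in> tuples n d. graph_of n S T = \<Gamma>}.
       of_int (eps d (graph_of n S T) (labelling_of n d S T)) * f T)"

definition compatible ::
    "nat \<Rightarrow> (nat \<Rightarrow> edge) \<Rightarrow> (nat \<Rightarrow> edge) \<Rightarrow> (nat \<Rightarrow> edge) \<Rightarrow> bool" where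
  "compatible d l1 l2 l \<longleftrightarrow>
     (\<forall>s\<in>{1..d}. fst (l1 s) = snd (l2 s) \<and> l s = (fst (l2 s), snd (l1 s)))"

definition compatible_pairs ::
    "nat \<Rightarrow> nat \<Rightarrow> edge multiset \<Rightarrow> edge multiset \<Rightarrow> (nat \<Rightarrow> edge)
      \<Rightarrow> ((nat \<Rightarrow> edge) \<times> (nat \<Rightarrow> edge)) set" where
  "compatible_pairs n d \<Gamma>1 \<Gamma>2 l =
     {(l1, l2). l1 \<in> labellings n d \<Gamma>1 \<and> l2 \<in> labellings n d \<Gamma>2 \<and> compatible d l1 l2 l}"

end

theory Submission
  imports Defs
begin

text \<open>
  Both kinds of basis element have the form \<open>f S \<mapsto> \<Sum> a (l S T) * f T\<close>, the sum running over the
  tuples \<open>T\<close> with graph \<open>\<Gamma>\<close>, where \<open>l S T\<close> is the labelling attached to \<open>(S, T)\<close>, and \<open>a\<close> is a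
  weight on labellings: constantly \<open>1\<close> for \<^const>\<open>xi\<close>, and the sign \<^const>\<open>eps\<close> for \<^const>\<open>zeta\<close>.
  In a product of two such operators the coefficient of \<open>f R\<close> at \<open>S\<close> is a sum over the
  intermediate tuples \<open>T\<close>. A tuple \<open>T\<close> is determined by the function that sends each point to the
  index of its block, and at each point this index is the vertex that the two labellings of a
  compatible pair have in common; so \<open>T \<mapsto> (l S T, l T R)\<close> is a bijection from the intermediate tuples to the
  pairs compatible with \<open>l S R\<close> (\<open>bij_betw_compatible_pairs\<close>). Hence the coefficient is the sum
  of the weights of the pairs compatible with \<open>l S R\<close>.

  It remains to see how this sum depends on the labelling \<open>l\<close>. Precomposition with a permutation
  \<open>w\<close> carries the pairs compatible with \<open>l\<close> to those compatible with \<open>l \<circ> w\<close>, and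
  multiplies a sign \<^const>\<open>eps\<close> by the sign of \<open>w\<close> (\<open>eps_comp_permutes\<close>). Any two labellings of one
  graph differ by such a \<open>w\<close>. If exactly one of the two factors carries a sign, the sum at \<open>l\<close> is
  therefore its value at the standard labelling times \<open>eps l\<close>; and if the graph has a multiple edge,
  then a transposition fixes \<open>l\<close>, so that the sum, an integer, equals its own negative and vanishes.
  This gives the products of a \<^const>\<open>xi\<close> and a \<^const>\<open>zeta\<close>
  (\<open>sum_compatible_pairs_alternating\<close>). If both factors carry a sign, the two signs of \<open>w\<close> cancel, and the sum depends on the graph alone.
\<close>

section \<open>Labellings of multigraphs\<close>

lemma labellings_iff:
  assumes "\<Gamma> \<in> multigraphs n d"
  shows "l \<in> labellings n d \<Gamma> \<longleftrightarrow>
    l \<in> {1..d} \<rightarrow>\<^sub>E {1..n} \<times> {1..n} \<and> image_mset l (mset_set {1..d}) = \<Gamma>"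
proof (cases "l \<in> {1..d} \<rightarrow>\<^sub>E {1..n} \<times> {1..n}")
  case True
  have count_l: "count (image_mset l (mset_set {1..d})) e = card {s \<in> {1..d}. l s = e}" for e
    by (simp add: count_image_mset_eq_card_vimage)
  have outside: "card {s \<in> {1..d}. l s = e} = count \<Gamma> e" if "e \<notin> {1..n} \<times> {1..n}" for e
  proof -
    have "{s \<in> {1..d}. l s = e} = {}"
      using True that by (blast dest: PiE_mem)
    moreover have "e \<notin># \<Gamma>"
      using assms that by (auto simp: multigraphs_def)
    ultimately show ?thesis
      by (metis card.empty not_in_iff)
  qed
  have "l \<in> labellings n d \<Gamma> \<longleftrightarrow>
      (\<forall>e \<in> {1..n} \<times> {1..n}. card {s \<in> {1..d}. l s = e} = count \<Gamma> e)"
    using True by (simp only: labellings_def mem_Collect_eq simp_thms)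
  also have "\<dots> \<longleftrightarrow> (\<forall>e. card {s \<in> {1..d}. l s = e} = count \<Gamma> e)"
    using outside by blast
  also have "\<dots> \<longleftrightarrow> image_mset l (mset_set {1..d}) = \<Gamma>"
    unfolding multiset_eq_iff count_l ..
  finally show ?thesis
    using True by blast
qed (auto simp: labellings_def)

lemma labelling_outside:
  assumes "l \<in> labellings n d \<Gamma>" "s \<notin> {1..d}"
  shows "l s = undefined"
proof -
  have "l \<in> extensional {1..d}"
    using assms(1) by (simp add: labellings_def PiE_def)
  then show ?thesis
    using assms(2) by (rule extensional_arb)
qed

lemma finite_multigraphs: "finite (multigraphs n d)"
  using finite_multisets_of_size[of "{1..n} \<times> {1..n}" d]
  by (simp add: multigraphs_def multisets_of_size_def)

lemma simple_graphs_subset: "simple_graphs n d \<subseteq> multigraphs n d"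
  by (auto simp: simple_graphs_def)

lemma labelling_not_simple:
  assumes "\<Gamma> \<in> multigraphs n d" "\<Gamma> \<notin> simple_graphs n d" "l \<in> labellings n d \<Gamma>"
  obtains s t where "s \<in> {1..d}" "t \<in> {1..d}" "s \<noteq> t" "l s = l t"
proof -
  obtain e where e: "\<not> count \<Gamma> e \<le> 1"
    using assms by (auto simp: simple_graphs_def)
  have "count \<Gamma> e = card {s \<in> {1..d}. l s = e}"
    using assms by (auto simp: labellings_iff count_image_mset_eq_card_vimage)
  then have "\<not> card {s \<in> {1..d}. l s = e} \<le> Suc 0"
    using e by simp
  then have "\<not> (\<forall>s\<in>{s \<in> {1..d}. l s = e}. \<forall>t\<in>{s \<in> {1..d}. l s = e}. s = t)"
    by (subst (asm) card_le_Suc0_iff_eq) auto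
  then show thesis
    using that by auto
qed

lemma labelling_simple_inj_on:
  assumes "\<Gamma> \<in> simple_graphs n d" "l \<in> labellings n d \<Gamma>"
  shows "inj_on l {1..d}"
proof (rule inj_onI)
  fix s t assume st: "s \<in> {1..d}" "t \<in> {1..d}" "l s = l t"
  have "card {r \<in> {1..d}. l r = l s} = count \<Gamma> (l s)"
    using assms subsetD[OF simple_graphs_subset assms(1)]
    by (auto simp: labellings_iff count_image_mset_eq_card_vimage)
  also have "\<dots> \<le> 1"
    using assms(1) unfolding simple_graphs_def by blast
  finally have "card {r \<in> {1..d}. l r = l s} \<le> Suc 0"
    by simp
  then show "s = t"
    using st by (subst (asm) card_le_Suc0_iff_eq) auto
qed

lemma std_labelling_in_labellings:
  assumes "\<Gamma> \<in> multigraphs n d"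
  shows "std_labelling d \<Gamma> \<in> labellings n d \<Gamma>"
proof -
  let ?xs = "sorted_list_of_multiset \<Gamma>"
  have len: "length ?xs = d"
    using assms by (metis (mono_tags) mem_Collect_eq mset_sorted_list_of_multiset multigraphs_def size_mset)
  have "?xs ! (s - 1) \<in> {1..n} \<times> {1..n}" if "s \<in> {1..d}" for s
  proof -
    have "?xs ! (s - 1) \<in> set ?xs"
      using that len by (intro nth_mem) auto
    then show ?thesis
      using assms by (auto simp: multigraphs_def)
  qed
  then have "std_labelling d \<Gamma> \<in> {1..d} \<rightarrow>\<^sub>E {1..n} \<times> {1..n}"
    unfolding std_labelling_def by (intro restrict_PiE_iff[THEN iffD2] ballI)
  moreover have "image_mset (std_labelling d \<Gamma>) (mset_set {1..d}) = \<Gamma>"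
  proof -
    have "image_mset (std_labelling d \<Gamma>) (mset_set {1..d}) =
        image_mset (\<lambda>s. ?xs ! (s - 1)) (mset_set (Suc ` {..<d}))"
      unfolding image_Suc_lessThan by (intro image_mset_cong) (simp add: std_labelling_def)
    also have "\<dots> = image_mset (\<lambda>s. ?xs ! s) (mset_set {..<d})"
      by (simp add: image_mset_mset_set[symmetric] multiset.map_comp comp_def)
    also have "\<dots> = mset (map (\<lambda>s. ?xs ! s) [0..<length ?xs])"
      by (simp add: len atLeast0LessThan)
    also have "\<dots> = \<Gamma>"
      by (simp add: map_nth)
    finally show ?thesis .
  qed
  ultimately show ?thesis
    using assms by (simp add: labellings_iff)
qed

lemma labelling_comp_permutes:
  assumes "\<Gamma> \<in> multigraphs n d" "l \<in> labellings n d \<Gamma>" "w permutes {1..d}"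
  shows "l \<circ> w \<in> labellings n d \<Gamma>"
proof -
  have "l \<circ> w \<in> {1..d} \<rightarrow>\<^sub>E {1..n} \<times> {1..n}"
  proof (rule PiE_I)
    fix s assume "s \<in> {1..d}"
    then have "w s \<in> {1..d}"
      using assms(3) permutes_in_image by metis
    then show "(l \<circ> w) s \<in> {1..n} \<times> {1..n}"
      using assms(2) unfolding labellings_def comp_apply by blast
  next
    fix s assume "s \<notin> {1..d}"
    then show "(l \<circ> w) s = undefined"
      using labelling_outside[OF assms(2)] permutes_not_in[OF assms(3)] by (metis comp_apply)
  qed
  moreover have "image_mset (l \<circ> w) (mset_set {1..d}) = \<Gamma>"
  proof -
    have "image_mset (l \<circ> w) (mset_set {1..d}) = image_mset l (image_mset w (mset_set {1..d}))"
      by (simp add: multiset.map_comp)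
    also have "image_mset w (mset_set {1..d}) = mset_set {1..d}"
      using assms(3) by (simp add: image_mset_mset_set permutes_inj_on permutes_image)
    also have "image_mset l (mset_set {1..d}) = \<Gamma>"
      using assms(1,2) by (simp add: labellings_iff)
    finally show ?thesis .
  qed
  ultimately show ?thesis
    unfolding labellings_iff[OF assms(1)] by (rule conjI)
qed

lemma labellings_differ_by_permutation:
  assumes "\<Gamma> \<in> multigraphs n d" "l \<in> labellings n d \<Gamma>" "l' \<in> labellings n d \<Gamma>"
  obtains w where "w permutes {1..d}" "l' = l \<circ> w"
proof -
  have "image_mset l' (mset_set {1..d}) = image_mset l (mset_set {1..d})"
    using assms by (simp add: labellings_iff)
  then obtain w where w: "w permutes {1..d}" "\<forall>s\<in>{1..d}. l' s = l (w s)"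
    by (rule image_mset_eq_implies_permutes[rotated]) auto
  have "l' = l \<circ> w"
  proof
    fix s
    show "l' s = (l \<circ> w) s"
    proof (cases "s \<in> {1..d}")
      case False
      then show ?thesis
        using labelling_outside[OF assms(2)] labelling_outside[OF assms(3)]
          permutes_not_in[OF w(1)] by (metis comp_apply)
    qed (use w in auto)
  qed
  with w(1) show thesis
    by (rule that)
qed

section \<open>The sign of a labelling\<close>

lemma eps_std_comp:
  assumes "\<Gamma> \<in> simple_graphs n d" "w permutes {1..d}"
  shows "eps d \<Gamma> (std_labelling d \<Gamma> \<circ> w) = sign w"
proof -
  let ?l = "std_labelling d \<Gamma> \<circ> w"
  have \<Gamma>: "\<Gamma> \<in> multigraphs n d"
    using assms(1) simple_graphs_subset by blast
  have "inj_on ?l {1..d}"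
    using labelling_comp_permutes[OF \<Gamma> std_labelling_in_labellings[OF \<Gamma>] assms(2)]
    by (rule labelling_simple_inj_on[OF assms(1)])
  moreover have inv_w: "inv w s \<in> {1..d}" if "s \<in> {1..d}" for s
    using that assms(2) by (metis permutes_in_image permutes_inv)
  moreover have "std_labelling d \<Gamma> s = ?l (inv w s)" for s
    using assms(2) by (simp add: permutes_inverses)
  ultimately have "the_inv_into {1..d} ?l (std_labelling d \<Gamma> s) = inv w s"
    if "s \<in> {1..d}" for s
    using that the_inv_into_f_f by metis
  then have "eps d \<Gamma> ?l = sign_on {1..d} (inv w)"
    unfolding eps_def by (intro sign_on_cong) auto
  also have "\<dots> = sign w"
    using permutes_inv[OF assms(2)] permutes_imp_permutation[OF _ assms(2)]
    by (simp add: sign_on_permutes[OF _ order.refl] sign_inverse)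
  finally show ?thesis .
qed

lemma eps_comp_permutes:
  assumes "\<Gamma> \<in> simple_graphs n d" "l \<in> labellings n d \<Gamma>" "w permutes {1..d}"
  shows "eps d \<Gamma> (l \<circ> w) = sign w * eps d \<Gamma> l"
proof -
  have \<Gamma>: "\<Gamma> \<in> multigraphs n d"
    using assms(1) simple_graphs_subset by blast
  obtain v where v: "v permutes {1..d}" and l: "l = std_labelling d \<Gamma> \<circ> v"
    using labellings_differ_by_permutation[OF \<Gamma> std_labelling_in_labellings[OF \<Gamma>] assms(2)] .
  have "eps d \<Gamma> (l \<circ> w) = sign (v \<circ> w)"
    unfolding l comp_assoc using assms v by (intro eps_std_comp permutes_compose)
  also have "\<dots> = sign v * sign w"
    using assms v by (intro sign_compose) (auto intro: permutes_imp_permutation[of "{1..d}"])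
  also have "sign v = eps d \<Gamma> l"
    unfolding l using eps_std_comp[OF assms(1) v] ..
  finally show ?thesis
    by (simp only: mult.commute)
qed

section \<open>Tuples as index functions\<close>

text \<open>The index of the block of a tuple that contains a given point, and the tuple whose blocks are
  the fibres of a given function.\<close>

definition block_index :: "nat \<Rightarrow> (nat \<Rightarrow> nat set) \<Rightarrow> nat \<Rightarrow> nat" where
  "block_index n S s = (THE i. i \<in> {1..n} \<and> s \<in> S i)"

definition tuple_of_index :: "nat \<Rightarrow> nat \<Rightarrow> (nat \<Rightarrow> nat) \<Rightarrow> nat \<Rightarrow> nat set" where
  "tuple_of_index n d g = (\<lambda>i\<in>{1..n}. {s \<in> {1..d}. g s = i})"

lemma block_index_props:
  assumes "S \<in> tuples n d" "s \<in> {1..d}"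
  shows "block_index n S s \<in> {1..n}"
    and "i \<in> {1..n} \<Longrightarrow> block_index n S s = i \<longleftrightarrow> s \<in> S i"
proof -
  have disj: "disjoint_family_on S {1..n}"
    using assms(1) by (simp add: tuples_def)
  have "s \<in> (\<Union>i\<in>{1..n}. S i)"
    using assms by (simp only: tuples_def mem_Collect_eq)
  then obtain j where j: "j \<in> {1..n}" "s \<in> S j"
    by blast
  have uniq: "i = j" if "i \<in> {1..n}" "s \<in> S i" for i
    using disj that j unfolding disjoint_family_on_def by (metis IntI empty_iff)
  have "block_index n S s = j"
    unfolding block_index_def using j uniq by (intro the_equality) blast+
  then show "block_index n S s \<in> {1..n}"
    and "i \<in> {1..n} \<Longrightarrow> block_index n S s = i \<longleftrightarrow> s \<in> S i"
    using j uniq by blast+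
qed

lemma tuple_block_subset:
  assumes "S \<in> tuples n d" "i \<in> {1..n}"
  shows "S i \<subseteq> {1..d}"
  using assms by (auto simp: tuples_def)

lemma finite_tuples: "finite (tuples n d)"
proof (rule finite_subset)
  show "tuples n d \<subseteq> {1..n} \<rightarrow>\<^sub>E Pow {1..d}"
    by (auto simp: tuples_def PiE_def)
qed (auto intro: finite_PiE)

lemma tuple_of_index_in_tuples:
  assumes "g \<in> {1..d} \<rightarrow> {1..n}"
  shows "tuple_of_index n d g \<in> tuples n d"
proof -
  have "(\<Union>i\<in>{1..n}. tuple_of_index n d g i) = {1..d}"
    using assms by (fastforce simp: tuple_of_index_def)
  then show ?thesis
    unfolding tuples_def by (auto simp: tuple_of_index_def disjoint_family_on_def)
qed

lemma block_index_tuple_of_index: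
  assumes "g \<in> {1..d} \<rightarrow> {1..n}" "s \<in> {1..d}"
  shows "block_index n (tuple_of_index n d g) s = g s"
proof -
  have "g s \<in> {1..n}"
    using assms by blast
  then show ?thesis
    using block_index_props(2)[OF tuple_of_index_in_tuples[OF assms(1)] assms(2), of "g s"] assms(2)
    by (simp add: tuple_of_index_def)
qed

lemma tuple_of_index_eqI:
  assumes "S \<in> tuples n d" "\<And>s. s \<in> {1..d} \<Longrightarrow> g s = block_index n S s"
  shows "tuple_of_index n d g = S"
proof
  fix i
  show "tuple_of_index n d g i = S i"
  proof (cases "i \<in> {1..n}")
    case True
    then have "tuple_of_index n d g i = {s \<in> {1..d}. g s = i}"
      by (simp add: tuple_of_index_def)
    also have "\<dots> = {s \<in> {1..d}. s \<in> S i}"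
      using assms(2) block_index_props(2)[OF assms(1) _ True]
      by (intro Collect_cong conj_cong refl) simp
    finally have "tuple_of_index n d g i = {s \<in> {1..d}. s \<in> S i}" .
    then show ?thesis
      using tuple_block_subset[OF assms(1) True] by blast
  next
    case False
    then show ?thesis
      using assms(1) by (auto simp: tuple_of_index_def tuples_def extensional_def)
  qed
qed

section \<open>The graph and the labelling of a pair of tuples\<close>

lemma labelling_of_apply:
  "s \<in> {1..d} \<Longrightarrow> labelling_of n d S T s = (block_index n T s, block_index n S s)"
  by (simp add: labelling_of_def block_index_def)

lemma labelling_of_in_PiE:
  assumes "S \<in> tuples n d" "T \<in> tuples n d"
  shows "labelling_of n d S T \<in> {1..d} \<rightarrow>\<^sub>E {1..n} \<times> {1..n}"
proof (rule PiE_I)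
  fix s assume "s \<in> {1..d}"
  then show "labelling_of n d S T s \<in> {1..n} \<times> {1..n}"
    using assms block_index_props(1) by (simp only: labelling_of_apply mem_Sigma_iff simp_thms)
qed (simp only: labelling_of_def restrict_apply if_False)

lemma count_graph_of:
  "count (graph_of n S T) (i, j) = (if (i, j) \<in> {1..n} \<times> {1..n} then card (S j \<inter> T i) else 0)"
proof -
  have "count (graph_of n S T) (i, j) = (\<Sum>e \<in> {1..n} \<times> {1..n}.
      if e = (i, j) then card (S j \<inter> T i) else 0)"
    unfolding graph_of_def count_sum by (intro sum.cong) (auto split: if_splits)
  also have "\<dots> = (if (i, j) \<in> {1..n} \<times> {1..n} then card (S j \<inter> T i) else 0)"
    by (intro sum.delta) simp
  finally show ?thesis .
qed

lemma graph_of_eq_image_mset: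
  assumes "S \<in> tuples n d" "T \<in> tuples n d"
  shows "graph_of n S T = image_mset (labelling_of n d S T) (mset_set {1..d})"
proof (rule multiset_eqI)
  fix e :: edge
  obtain i j where e: "e = (i, j)"
    by fastforce
  have count_l: "count (image_mset (labelling_of n d S T) (mset_set {1..d})) e =
      card {s \<in> {1..d}. labelling_of n d S T s = e}"
    by (simp add: count_image_mset_eq_card_vimage)
  show "count (graph_of n S T) e = count (image_mset (labelling_of n d S T) (mset_set {1..d})) e"
  proof (cases "e \<in> {1..n} \<times> {1..n}")
    case True
    then have ij: "i \<in> {1..n}" "j \<in> {1..n}"
      unfolding e by blast+
    have "{s \<in> {1..d}. labelling_of n d S T s = e} = {s \<in> {1..d}. s \<in> T i \<and> s \<in> S j}"
      using block_index_props(2)[OF assms(1) _ ij(2)] block_index_props(2)[OF assms(2) _ ij(1)]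
      by (intro Collect_cong conj_cong refl) (simp add: labelling_of_apply e)
    also have "\<dots> = S j \<inter> T i"
      using tuple_block_subset[OF assms(1) ij(2)] by blast
    finally show ?thesis
      using True unfolding count_l by (simp only: e count_graph_of if_True)
  next
    case False
    have "{s \<in> {1..d}. labelling_of n d S T s = e} = {}"
      using labelling_of_in_PiE[OF assms] False by (blast dest: PiE_mem)
    then show ?thesis
      using False unfolding count_l by (simp only: e count_graph_of if_False card.empty)
  qed
qed

lemma graph_of_in_multigraphs:
  assumes "S \<in> tuples n d" "T \<in> tuples n d"
  shows "graph_of n S T \<in> multigraphs n d"
proof -
  have "labelling_of n d S T ` {1..d} \<subseteq> {1..n} \<times> {1..n}"
    using labelling_of_in_PiE[OF assms] by blast
  then show ?thesis
    by (simp add: multigraphs_def graph_of_eq_image_mset[OF assms])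
qed

lemma labelling_of_in_labellings_iff:
  assumes "S \<in> tuples n d" "T \<in> tuples n d" "\<Gamma> \<in> multigraphs n d"
  shows "labelling_of n d S T \<in> labellings n d \<Gamma> \<longleftrightarrow> graph_of n S T = \<Gamma>"
  using labelling_of_in_PiE[OF assms(1,2)] assms(3)
  by (simp only: labellings_iff graph_of_eq_image_mset[OF assms(1,2)] simp_thms)

section \<open>Intermediate tuples and compatible pairs\<close>

text \<open>The inverse sends \<open>(l1, l2)\<close> to the tuple whose block indices are the first components of
  \<open>l1\<close>, which compatibility makes equal to the second components of \<open>l2\<close>.\<close>

lemma bij_betw_compatible_pairs:
  assumes "S \<in> tuples n d" "R \<in> tuples n d" "\<Gamma>1 \<in> multigraphs n d" "\<Gamma>2 \<in> multigraphs n d"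
  shows "bij_betw (\<lambda>T. (labelling_of n d S T, labelling_of n d T R))
    {T \<in> tuples n d. graph_of n S T = \<Gamma>1 \<and> graph_of n T R = \<Gamma>2}
    (compatible_pairs n d \<Gamma>1 \<Gamma>2 (labelling_of n d S R))"
    (is "bij_betw ?f ?A ?B")
proof (rule bij_betw_byWitness)
  let ?g = "\<lambda>(l1, l2). tuple_of_index n d (\<lambda>s. fst (l1 s))"
  have g: "?g p \<in> tuples n d \<and> ?f (?g p) = p" if "p \<in> ?B" for p
  proof -
    obtain l1 l2 where p: "p = (l1, l2)"
      by fastforce
    have l: "l1 \<in> {1..d} \<rightarrow>\<^sub>E {1..n} \<times> {1..n}" "l2 \<in> {1..d} \<rightarrow>\<^sub>E {1..n} \<times> {1..n}"
      and comp: "\<And>s. s \<in> {1..d} \<Longrightarrow> fst (l1 s) = snd (l2 s) \<and>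
        (block_index n R s, block_index n S s) = (fst (l2 s), snd (l1 s))"
      using that assms
      by (simp_all add: p compatible_pairs_def labellings_iff compatible_def labelling_of_apply)
    have idx: "(\<lambda>s. fst (l1 s)) \<in> {1..d} \<rightarrow> {1..n}"
      using l(1) by (intro Pi_I) (metis PiE_mem mem_Times_iff)
    have "labelling_of n d S (?g p) s = l1 s \<and> labelling_of n d (?g p) R s = l2 s" for s
    proof (cases "s \<in> {1..d}")
      case True
      then show ?thesis
        using comp[OF True] block_index_tuple_of_index[OF idx True]
        by (simp only: labelling_of_apply p prod.case) (simp add: prod_eq_iff)
    next
      case False
      then have "l1 s = undefined" "l2 s = undefined"
        using that labelling_outside unfolding p compatible_pairs_def by blast+
      then show ?thesis
        using False by (simp only: labelling_of_def restrict_apply if_False simp_thms)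
    qed
    then have "?f (?g p) = p"
      by (auto simp: p)
    then show ?thesis
      using tuple_of_index_in_tuples[OF idx] by (simp add: p)
  qed
  show "\<forall>T\<in>?A. ?g (?f T) = T"
    by (auto intro!: tuple_of_index_eqI simp: labelling_of_apply)
  show "\<forall>p\<in>?B. ?f (?g p) = p"
    using g by blast
  show "?f ` ?A \<subseteq> ?B"
  proof (rule image_subsetI)
    fix T assume "T \<in> ?A"
    then show "?f T \<in> ?B"
      using assms by (simp add: compatible_pairs_def labelling_of_in_labellings_iff)
        (simp add: compatible_def labelling_of_apply)
  qed
  show "?g ` ?B \<subseteq> ?A"
  proof (rule image_subsetI)
    fix p assume pB: "p \<in> ?B"
    have "?g p \<in> tuples n d" "?f (?g p) = p"
      using g[OF pB] by (simp_all only: simp_thms)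
    moreover from this(2) have "?f (?g p) \<in> ?B"
      using pB by (simp only:)
    then have "labelling_of n d S (?g p) \<in> labellings n d \<Gamma>1"
      "labelling_of n d (?g p) R \<in> labellings n d \<Gamma>2"
      by (simp_all add: compatible_pairs_def)
    ultimately show "?g p \<in> ?A"
      using labelling_of_in_labellings_iff[OF assms(1) _ assms(3)]
        labelling_of_in_labellings_iff[OF _ assms(2,4)] by blast
  qed
qed

lemma compatible_comp_permutes:
  assumes "compatible d l1 l2 l" "w permutes {1..d}"
  shows "compatible d (l1 \<circ> w) (l2 \<circ> w) (l \<circ> w)"
  unfolding compatible_def
proof
  fix s assume "s \<in> {1..d}"
  then have "w s \<in> {1..d}"
    using assms(2) permutes_in_image by metis
  then show "fst ((l1 \<circ> w) s) = snd ((l2 \<circ> w) s) \<and>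
      (l \<circ> w) s = (fst ((l2 \<circ> w) s), snd ((l1 \<circ> w) s))"
    using assms(1) by (simp add: compatible_def)
qed

lemma sum_compatible_pairs_comp:
  assumes "\<Gamma>1 \<in> multigraphs n d" "\<Gamma>2 \<in> multigraphs n d" "w permutes {1..d}"
  shows "(\<Sum>(l1, l2) \<in> compatible_pairs n d \<Gamma>1 \<Gamma>2 (l \<circ> w). h l1 l2) =
    (\<Sum>(l1, l2) \<in> compatible_pairs n d \<Gamma>1 \<Gamma>2 l. h (l1 \<circ> w) (l2 \<circ> w))"
proof -
  have inv: "inv w permutes {1..d}"
    using assms(3) by (rule permutes_inv)
  have cancel: "(k \<circ> w) \<circ> inv w = k" "(k \<circ> inv w) \<circ> w = k" for k :: "nat \<Rightarrow> edge"
    using assms(3) by (simp_all add: comp_assoc permutes_inv_o)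
  have mem: "(k1 \<circ> v, k2 \<circ> v) \<in> compatible_pairs n d \<Gamma>1 \<Gamma>2 (k \<circ> v)"
    if "(k1, k2) \<in> compatible_pairs n d \<Gamma>1 \<Gamma>2 k" "v permutes {1..d}" for k1 k2 k v
    using that assms(1,2)
    by (simp add: compatible_pairs_def labelling_comp_permutes compatible_comp_permutes)
  have mem': "(k1 \<circ> inv w, k2 \<circ> inv w) \<in> compatible_pairs n d \<Gamma>1 \<Gamma>2 l"
    if "(k1, k2) \<in> compatible_pairs n d \<Gamma>1 \<Gamma>2 (l \<circ> w)" for k1 k2
    using mem[OF that inv] by (simp only: cancel)
  show ?thesis
    by (rule sum.reindex_bij_witness[where i = "\<lambda>(l1, l2). (l1 \<circ> w, l2 \<circ> w)"
          and j = "\<lambda>(l1, l2). (l1 \<circ> inv w, l2 \<circ> inv w)"])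
      (use mem[OF _ assms(3)] mem' in \<open>auto simp only: cancel prod.case split: prod.splits\<close>)
qed

text \<open>Applied to a product with exactly one signed factor, \<open>h\<close> being the sign of the labelling of
  that factor.\<close>

lemma sum_compatible_pairs_alternating:
  fixes h :: "(nat \<Rightarrow> edge) \<Rightarrow> (nat \<Rightarrow> edge) \<Rightarrow> int"
  assumes "\<Gamma>1 \<in> multigraphs n d" "\<Gamma>2 \<in> multigraphs n d"
    and "\<Gamma> \<in> multigraphs n d" "l \<in> labellings n d \<Gamma>"
    and alternating: "\<And>l1 l2 w. \<lbrakk>l1 \<in> labellings n d \<Gamma>1; l2 \<in> labellings n d \<Gamma>2;
      w permutes {1..d}\<rbrakk> \<Longrightarrow> h (l1 \<circ> w) (l2 \<circ> w) = sign w * h l1 l2"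
  shows "(\<Sum>(l1, l2) \<in> compatible_pairs n d \<Gamma>1 \<Gamma>2 l. h l1 l2) =
    (if \<Gamma> \<in> simple_graphs n d
     then (\<Sum>(l1, l2) \<in> compatible_pairs n d \<Gamma>1 \<Gamma>2 (std_labelling d \<Gamma>). h l1 l2) * eps d \<Gamma> l
     else 0)"
proof -
  let ?c = "\<lambda>l. \<Sum>(l1, l2) \<in> compatible_pairs n d \<Gamma>1 \<Gamma>2 l. h l1 l2"
  have twist: "?c (k \<circ> w) = sign w * ?c k" if "w permutes {1..d}" for w k
  proof -
    have "?c (k \<circ> w) = (\<Sum>(l1, l2) \<in> compatible_pairs n d \<Gamma>1 \<Gamma>2 k. sign w * h l1 l2)"
      unfolding sum_compatible_pairs_comp[OF assms(1,2) that]
      using that by (intro sum.cong) (auto simp: compatible_pairs_def alternating)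
    then show ?thesis
      by (simp add: sum_distrib_left case_prod_unfold)
  qed
  show ?thesis
  proof (cases "\<Gamma> \<in> simple_graphs n d")
    case True
    obtain w where w: "w permutes {1..d}" and l: "l = std_labelling d \<Gamma> \<circ> w"
      using labellings_differ_by_permutation[OF assms(3) std_labelling_in_labellings assms(4)]
        assms(3) by metis
    have "?c l = sign w * ?c (std_labelling d \<Gamma>)"
      unfolding l by (rule twist[OF w])
    also have "sign w = eps d \<Gamma> l"
      unfolding l using eps_std_comp[OF True w] ..
    finally show ?thesis
      using True by (simp add: mult.commute)
  next
    case False
    obtain s t where st: "s \<in> {1..d}" "t \<in> {1..d}" "s \<noteq> t" "l s = l t"
      using labelling_not_simple[OF assms(3) False assms(4)] .
    \<comment> \<open>Exchanging two labels \<open>s\<close> and \<open>t\<close> of a multiple edge does not change the labelling.\<close>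
    have "l \<circ> transpose s t = l"
      using st(4) by (auto simp: fun_eq_iff transpose_def)
    then have "?c l = - ?c l"
      using twist[OF permutes_swap_id[OF st(1,2)], of l] st(3) by (simp add: sign_swap_id)
    then show ?thesis
      using False by simp
  qed
qed

section \<open>Products of weighted operators\<close>

text \<open>The common form of the two families of basis elements: the entry at \<open>(S, T)\<close> of the operator is
  \<open>0\<close> unless the pair has graph \<open>\<Gamma>\<close>, and is then an integer function \<open>a\<close> of the labelling of the pair.\<close>

definition weighted_op ::
    "nat \<Rightarrow> nat \<Rightarrow> edge multiset \<Rightarrow> ((nat \<Rightarrow> edge) \<Rightarrow> int) \<Rightarrow> 'a::field operator" where
  "weighted_op n d \<Gamma> a = (\<lambda>f\<in>fun_space n d. \<lambda>S\<in>tuples n d.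
     \<Sum>T\<in>{T \<in> tuples n d. graph_of n S T = \<Gamma>}. of_int (a (labelling_of n d S T)) * f T)"

lemma xi_eq_weighted_op: "xi n d \<Gamma> = weighted_op n d \<Gamma> (\<lambda>_. 1)"
  by (simp add: xi_def weighted_op_def)

lemma zeta_eq_weighted_op: "zeta n d \<Gamma> = weighted_op n d \<Gamma> (eps d \<Gamma>)"
  unfolding zeta_def weighted_op_def by (intro restrict_ext sum.cong) auto

lemma weighted_op_in_fun_space: "f \<in> fun_space n d \<Longrightarrow> weighted_op n d \<Gamma> a f \<in> fun_space n d"
  unfolding weighted_op_def by (simp add: fun_space_def)

text \<open>The product has coefficient \<open>c \<Gamma>\<close> at \<open>\<Gamma>\<close> as soon as, for each labelling \<open>l\<close> of \<open>\<Gamma>\<close>, the weights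
  of the pairs compatible with \<open>l\<close> add up to \<open>c \<Gamma>\<close> times the weight of \<open>l\<close> itself. The graphs
  outside \<open>G\<close> are those at which these sums vanish.\<close>

lemma compose_weighted_op:
  assumes "\<Gamma>1 \<in> multigraphs n d" "\<Gamma>2 \<in> multigraphs n d" "G \<subseteq> multigraphs n d"
    and coeff: "\<And>\<Gamma> l. \<lbrakk>\<Gamma> \<in> multigraphs n d; l \<in> labellings n d \<Gamma>\<rbrakk> \<Longrightarrow>
      (\<Sum>(l1, l2) \<in> compatible_pairs n d \<Gamma>1 \<Gamma>2 l. a1 l1 * a2 l2) =
      (if \<Gamma> \<in> G then c \<Gamma> * b \<Gamma> l else 0)"
  shows "compose (fun_space n d) (weighted_op n d \<Gamma>1 a1) (weighted_op n d \<Gamma>2 a2 :: 'a::field operator) =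
    lin_comb n d G (\<lambda>\<Gamma>. of_int (c \<Gamma>)) (\<lambda>\<Gamma>. weighted_op n d \<Gamma> (b \<Gamma>))"
  unfolding compose_def lin_comb_def
proof (intro restrict_ext)
  fix f :: "(nat \<Rightarrow> nat set) \<Rightarrow> 'a"
  assume f: "f \<in> fun_space n d"
  let ?B = "tuples n d" and ?l = "labelling_of n d" and ?\<gamma> = "graph_of n"
  let ?rhs = "\<lambda>S\<in>?B. \<Sum>\<Gamma>\<in>G. of_int (c \<Gamma>) * weighted_op n d \<Gamma> (b \<Gamma>) f S"
  have pointwise: "weighted_op n d \<Gamma>1 a1 (weighted_op n d \<Gamma>2 a2 f) S =
      (\<Sum>\<Gamma>\<in>G. of_int (c \<Gamma>) * weighted_op n d \<Gamma> (b \<Gamma>) f S)" if S: "S \<in> ?B" for S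
  proof -
    have "weighted_op n d \<Gamma>1 a1 (weighted_op n d \<Gamma>2 a2 f) S =
        (\<Sum>T\<in>{T \<in> ?B. ?\<gamma> S T = \<Gamma>1}. \<Sum>R\<in>{R \<in> ?B. ?\<gamma> T R = \<Gamma>2}.
          of_int (a1 (?l S T)) * (of_int (a2 (?l T R)) * f R))"
      using S f weighted_op_in_fun_space[OF f, of \<Gamma>2 a2]
      by (simp add: weighted_op_def sum_distrib_left)
    also have "\<dots> = (\<Sum>R\<in>?B. \<Sum>T\<in>{T \<in> {T \<in> ?B. ?\<gamma> S T = \<Gamma>1}. ?\<gamma> T R = \<Gamma>2}.
          of_int (a1 (?l S T)) * (of_int (a2 (?l T R)) * f R))"
      using finite_tuples by (intro sum.swap_restrict) auto
    also have "\<dots> = (\<Sum>R\<in>?B. if ?\<gamma> S R \<in> G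
        then of_int (c (?\<gamma> S R)) * (of_int (b (?\<gamma> S R) (?l S R)) * f R) else 0)"
    proof (rule sum.cong[OF refl])
      fix R assume R: "R \<in> ?B"
      have "(\<Sum>T\<in>{T \<in> {T \<in> ?B. ?\<gamma> S T = \<Gamma>1}. ?\<gamma> T R = \<Gamma>2}.
            of_int (a1 (?l S T)) * (of_int (a2 (?l T R)) * f R)) =
          of_int (\<Sum>T\<in>{T \<in> ?B. ?\<gamma> S T = \<Gamma>1 \<and> ?\<gamma> T R = \<Gamma>2}. a1 (?l S T) * a2 (?l T R)) * f R"
        by (simp add: sum_distrib_right mult.assoc)
      also have "(\<Sum>T\<in>{T \<in> ?B. ?\<gamma> S T = \<Gamma>1 \<and> ?\<gamma> T R = \<Gamma>2}. a1 (?l S T) * a2 (?l T R)) =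
          (\<Sum>(l1, l2) \<in> compatible_pairs n d \<Gamma>1 \<Gamma>2 (?l S R). a1 l1 * a2 l2)"
        using sum.reindex_bij_betw[OF bij_betw_compatible_pairs[OF S R assms(1,2)],
            of "\<lambda>(l1, l2). a1 l1 * a2 l2"] by simp
      also have "\<dots> = (if ?\<gamma> S R \<in> G then c (?\<gamma> S R) * b (?\<gamma> S R) (?l S R) else 0)"
        using S R by (intro coeff) (simp_all add: graph_of_in_multigraphs labelling_of_in_labellings_iff)
      finally show "(\<Sum>T\<in>{T \<in> {T \<in> ?B. ?\<gamma> S T = \<Gamma>1}. ?\<gamma> T R = \<Gamma>2}.
            of_int (a1 (?l S T)) * (of_int (a2 (?l T R)) * f R)) = (if ?\<gamma> S R \<in> G
          then of_int (c (?\<gamma> S R)) * (of_int (b (?\<gamma> S R) (?l S R)) * f R) else 0)"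
        by (simp add: mult.assoc)
    qed
    also have "\<dots> = (\<Sum>R\<in>{R \<in> ?B. ?\<gamma> S R \<in> G}.
        of_int (c (?\<gamma> S R)) * (of_int (b (?\<gamma> S R) (?l S R)) * f R))"
      using finite_tuples by (intro sum.inter_filter[symmetric])
    also have "\<dots> = (\<Sum>\<Gamma>\<in>G. \<Sum>R\<in>{R \<in> {R \<in> ?B. ?\<gamma> S R \<in> G}. ?\<gamma> S R = \<Gamma>}.
        of_int (c (?\<gamma> S R)) * (of_int (b (?\<gamma> S R) (?l S R)) * f R))"
      using finite_tuples finite_subset[OF assms(3) finite_multigraphs]
      by (intro sum.group[symmetric]) auto
    also have "\<dots> = (\<Sum>\<Gamma>\<in>G. \<Sum>R\<in>{R \<in> ?B. ?\<gamma> S R = \<Gamma>}. of_int (c \<Gamma>) * (of_int (b \<Gamma> (?l S R)) * f R))"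
      by (intro sum.cong) auto
    also have "\<dots> = (\<Sum>\<Gamma>\<in>G. of_int (c \<Gamma>) * weighted_op n d \<Gamma> (b \<Gamma>) f S)"
      using S f by (simp add: weighted_op_def sum_distrib_left)
    finally show ?thesis .
  qed
  show "weighted_op n d \<Gamma>1 a1 (weighted_op n d \<Gamma>2 a2 f) = ?rhs"
  proof (rule extensionalityI[where A = ?B])
    show "weighted_op n d \<Gamma>1 a1 (weighted_op n d \<Gamma>2 a2 f) \<in> extensional ?B"
      using weighted_op_in_fun_space[OF weighted_op_in_fun_space[OF f]]
      by (simp only: fun_space_def PiE_def Int_iff)
    show "?rhs \<in> extensional ?B"
      by (rule restrict_extensional)
  qed (simp only: pointwise restrict_apply if_True)
qed

section \<open>The multiplication rules\<close>

theorem theorem2p25: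
  fixes n d :: nat
  assumes "n \<ge> 1" and "d \<ge> 1" and "CHAR('a::field) \<noteq> 2"
  shows
    "(\<forall>\<Gamma>1 \<in> multigraphs n d. \<forall>\<Gamma>2 \<in> simple_graphs n d.
        compose (fun_space n d) (xi n d \<Gamma>1) (zeta n d \<Gamma>2 :: 'a operator) =
        lin_comb n d (simple_graphs n d)
          (\<lambda>\<Gamma>. of_int (\<Sum>(l1, l2) \<in> compatible_pairs n d \<Gamma>1 \<Gamma>2 (std_labelling d \<Gamma>). eps d \<Gamma>2 l2))
          (zeta n d)) \<and>
     (\<forall>\<Gamma>1 \<in> simple_graphs n d. \<forall>\<Gamma>2 \<in> multigraphs n d.
        compose (fun_space n d) (zeta n d \<Gamma>1) (xi n d \<Gamma>2 :: 'a operator) =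
        lin_comb n d (simple_graphs n d)
          (\<lambda>\<Gamma>. of_int (\<Sum>(l1, l2) \<in> compatible_pairs n d \<Gamma>1 \<Gamma>2 (std_labelling d \<Gamma>). eps d \<Gamma>1 l1))
          (zeta n d)) \<and>
     (\<forall>\<Gamma>1 \<in> simple_graphs n d. \<forall>\<Gamma>2 \<in> simple_graphs n d.
        \<forall>l. (\<forall>\<Gamma> \<in> multigraphs n d. l \<Gamma> \<in> labellings n d \<Gamma>) \<longrightarrow>
        compose (fun_space n d) (zeta n d \<Gamma>1) (zeta n d \<Gamma>2 :: 'a operator) =
        lin_comb n d (multigraphs n d)
          (\<lambda>\<Gamma>. of_int (\<Sum>(l1, l2) \<in> compatible_pairs n d \<Gamma>1 \<Gamma>2 (l \<Gamma>). eps d \<Gamma>1 l1 * eps d \<Gamma>2 l2))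
          (xi n d))"
proof (intro conjI ballI allI impI)
  fix \<Gamma>1 \<Gamma>2 assume *: "\<Gamma>1 \<in> multigraphs n d" "\<Gamma>2 \<in> simple_graphs n d"
  then have \<Gamma>2: "\<Gamma>2 \<in> multigraphs n d"
    using simple_graphs_subset by blast
  show "compose (fun_space n d) (xi n d \<Gamma>1) (zeta n d \<Gamma>2 :: 'a operator) =
      lin_comb n d (simple_graphs n d)
        (\<lambda>\<Gamma>. of_int (\<Sum>(l1, l2) \<in> compatible_pairs n d \<Gamma>1 \<Gamma>2 (std_labelling d \<Gamma>). eps d \<Gamma>2 l2))
        (zeta n d)"
    unfolding xi_eq_weighted_op zeta_eq_weighted_op
  proof (rule compose_weighted_op[OF *(1) \<Gamma>2 simple_graphs_subset])
    fix \<Gamma> l assume "\<Gamma> \<in> multigraphs n d" "l \<in> labellings n d \<Gamma>"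
    from sum_compatible_pairs_alternating[OF *(1) \<Gamma>2 this, where h = "\<lambda>_ l2. eps d \<Gamma>2 l2"]
    show "(\<Sum>(l1, l2) \<in> compatible_pairs n d \<Gamma>1 \<Gamma>2 l. 1 * eps d \<Gamma>2 l2) =
        (if \<Gamma> \<in> simple_graphs n d
         then (\<Sum>(l1, l2) \<in> compatible_pairs n d \<Gamma>1 \<Gamma>2 (std_labelling d \<Gamma>). eps d \<Gamma>2 l2) * eps d \<Gamma> l
         else 0)"
      using eps_comp_permutes[OF *(2)] by simp
  qed
next
  fix \<Gamma>1 \<Gamma>2 assume *: "\<Gamma>1 \<in> simple_graphs n d" "\<Gamma>2 \<in> multigraphs n d"
  then have \<Gamma>1: "\<Gamma>1 \<in> multigraphs n d"
    using simple_graphs_subset by blast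
  show "compose (fun_space n d) (zeta n d \<Gamma>1) (xi n d \<Gamma>2 :: 'a operator) =
      lin_comb n d (simple_graphs n d)
        (\<lambda>\<Gamma>. of_int (\<Sum>(l1, l2) \<in> compatible_pairs n d \<Gamma>1 \<Gamma>2 (std_labelling d \<Gamma>). eps d \<Gamma>1 l1))
        (zeta n d)"
    unfolding xi_eq_weighted_op zeta_eq_weighted_op
  proof (rule compose_weighted_op[OF \<Gamma>1 *(2) simple_graphs_subset])
    fix \<Gamma> l assume "\<Gamma> \<in> multigraphs n d" "l \<in> labellings n d \<Gamma>"
    from sum_compatible_pairs_alternating[OF \<Gamma>1 *(2) this, where h = "\<lambda>l1 _. eps d \<Gamma>1 l1"]
    show "(\<Sum>(l1, l2) \<in> compatible_pairs n d \<Gamma>1 \<Gamma>2 l. eps d \<Gamma>1 l1 * 1) =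
        (if \<Gamma> \<in> simple_graphs n d
         then (\<Sum>(l1, l2) \<in> compatible_pairs n d \<Gamma>1 \<Gamma>2 (std_labelling d \<Gamma>). eps d \<Gamma>1 l1) * eps d \<Gamma> l
         else 0)"
      using eps_comp_permutes[OF *(1)] by simp
  qed
next
  fix \<Gamma>1 \<Gamma>2 and l :: "edge multiset \<Rightarrow> nat \<Rightarrow> edge"
  assume *: "\<Gamma>1 \<in> simple_graphs n d" "\<Gamma>2 \<in> simple_graphs n d"
    and l: "\<forall>\<Gamma> \<in> multigraphs n d. l \<Gamma> \<in> labellings n d \<Gamma>"
  then have \<Gamma>12: "\<Gamma>1 \<in> multigraphs n d" "\<Gamma>2 \<in> multigraphs n d"
    using simple_graphs_subset by blast+
  let ?c = "\<lambda>k. \<Sum>(l1, l2) \<in> compatible_pairs n d \<Gamma>1 \<Gamma>2 k. eps d \<Gamma>1 l1 * eps d \<Gamma>2 l2"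
  have "?c k = ?c (l \<Gamma>)" if \<Gamma>: "\<Gamma> \<in> multigraphs n d" and k: "k \<in> labellings n d \<Gamma>" for \<Gamma> k
  proof -
    have "l \<Gamma> \<in> labellings n d \<Gamma>"
      using l \<Gamma> by blast
    then obtain w where w: "w permutes {1..d}" and kw: "k = l \<Gamma> \<circ> w"
      using labellings_differ_by_permutation[OF \<Gamma> _ k] by metis
    \<comment> \<open>Each factor contributes the sign of the relabelling, and the square of that sign is \<open>1\<close>.\<close>
    have "eps d \<Gamma>1 (l1 \<circ> w) * eps d \<Gamma>2 (l2 \<circ> w) = eps d \<Gamma>1 l1 * eps d \<Gamma>2 l2"
      if "l1 \<in> labellings n d \<Gamma>1" "l2 \<in> labellings n d \<Gamma>2" for l1 l2
      using that * w by (simp add: eps_comp_permutes mult.left_commute mult.assoc)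
    then show ?thesis
      unfolding kw sum_compatible_pairs_comp[OF \<Gamma>12 w]
      by (intro sum.cong) (auto simp: compatible_pairs_def)
  qed
  then show "compose (fun_space n d) (zeta n d \<Gamma>1) (zeta n d \<Gamma>2 :: 'a operator) =
      lin_comb n d (multigraphs n d) (\<lambda>\<Gamma>. of_int (?c (l \<Gamma>))) (xi n d)"
    unfolding xi_eq_weighted_op zeta_eq_weighted_op
    using \<Gamma>12 by (intro compose_weighted_op) auto
qed

end
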